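(* Let $v$ be a flow on a compact metric space $X$. Then the Morse graph $G_v$ of $v$ is a quotient space of the abstract orbit space $X/\langle v\rangle$ with the pre-orders $\leq_\alpha$ and $\leq_\omega$. In particular, the underlying space of the Morse graph $G_v$ is a quotient space of the abstract orbit space $X/\langle v\rangle$.
   Context: A flow on a topological space $X$ is a continuous $\mathbb{R}$-action $v:\mathbb{R}\times X\to X$, $v_t=v(t,\cdot)$; $O(x)=\{v_t(x): t\in\mathbb{R}\}$. Limit sets: $\omega(x)=\bigcap_{n\in\mathbb{R}}\overline{\{v_t(x): t>n\}}$, $\alpha(x)=\bigcap_{n\in\mathbb{R}}\overline{\{v_t(x): t<n\}}$. A point $x$ is singular if $v_t(x)=x$ for all $t$, and periodic if there is $T>0$ with $v_T(x)=x$ and $v_t(x)\ne x$ for $t\in(0,T)$. $\mathrm{Sing}(v)$, $\mathrm{Per}(v)$ denote the sets of singular and periodic points, and $\mathrm{Cl}(v)=\mathrm{Sing}(v)\sqcup\mathrm{Per}(v)$. A point $x$ is recurrent if $x\in\alpha(x)\cup\omega(x)$. $\mathrm{R}(v)$ is the set of recurrent points not in $\mathrm{Cl}(v)$ and $\mathrm{P}(v)$ is the set of non-recurrent points, so $X=\mathrm{Sing}(v)\sqcup\mathrm{Per}(v)\sqcup\mathrm{P}(v)\sqcup\mathrm{R}(v)$. Abstract orbits: $\alpha'(x)=\alpha(x)\setminus O(x)$, $\omega'(x)=\omega(x)\setminus O(x)$. $[x]'$ is the connected component containing $x$ of $\{y\in X:\alpha'(y)=\alpha'(x),\ \omega'(y)=\omega'(x)\}$.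 $[x]''$ is the connected component containing $x$ of $[x]'\cap Z$, where $Z$ is the one of $\mathrm{Sing}(v),\mathrm{Per}(v),\mathrm{P}(v),\mathrm{R}(v)$ containing $x$. $\hat O(x)=\{y\in X:\overline{O(y)}=\overline{O(x)}\}$. The abstract orbit of $x$ is $\langle x\rangle=[x]''$ if $x\notin\mathrm{R}(v)$ and $\langle x\rangle=\hat O(x)$ if $x\in \mathrm{R}(v)$. These sets partition $X$, and the abstract orbit space $X/\langle v\rangle$ is the corresponding quotient space. On $X/\langle v\rangle$: $\langle x\rangle\leq_\alpha\langle y\rangle$ if $\langle x\rangle=\langle y\rangle$ or $x_1\in\alpha(y_1)$ for some $x_1\in\langle x\rangle$, $y_1\in\langle y\rangle$; $\langle x\rangle\leq_\omega\langle y\rangle$ if $\langle x\rangle=\langle y\rangle$ or $x_1\in\omega(y_1)$ for some $x_1\in\langle x\rangle$, $y_1\in\langle y\rangle$. Morse graph: let $d$ be the metric of $X$. For $\varepsilon>0$, $T>0$, an $(\varepsilon,T)$-chain from $x$ to $y$ consists of points $x=x_0,\dots,x_{k+1}=y$ and times $t_0,\dots,t_k>T$ with $d(v_{t_i}(x_i),x_{i+1})<\varepsilon$ for $0\le i\le k$. A point $x$ is chain recurrent if for all $\varepsilon,T>0$ there is an $(\varepsilon,T)$-chain from $x$ to $x$; $CR(v)$ is the set of chain recurrent points. The Morse sets $M_i$ are the connected components of $CR(v)$. For $j\neq k$ the connecting orbit set is $D_{j,k}=\{x\in X:\alpha(x)\subseteq M_j,\ \omega(x)\subseteq M_k\}$,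 and $X\setminus\bigsqcup_i M_i=\bigsqcup_{j\ne k} D_{j,k}$. The Morse graph $G_v$ is the directed graph with vertex set $\{M_i\}$ and directed edge set $\{(M_j,M_k): D_{j,k}\ne\emptyset\}$; it is regarded as a quotient space of $X$ (its underlying space, obtained from the decomposition of $X$ into the vertices $M_i$ and the nonempty connecting orbit sets $D_{j,k}$) with a directed structure. *)

theory Defs
  imports
    "HOL-Analysis.Analysis"
    "HOL-Library.Disjoint_Sets"
    "Graph_Theory.Digraph"
begin

section \<open>Flows, limit sets and types of points\<close>

definition flow :: "(real \<Rightarrow> 'a::topological_space \<Rightarrow> 'a) \<Rightarrow> bool" where
  "flow v \<longleftrightarrow> continuous_on UNIV (\<lambda>(t, x). v t x) \<and>
     (\<forall>x. v 0 x = x) \<and> (\<forall>s t x. v (s + t) x = v s (v t x))"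

definition orbit :: "(real \<Rightarrow> 'a::topological_space \<Rightarrow> 'a) \<Rightarrow> 'a \<Rightarrow> 'a set" where
  "orbit v x = {v t x |t. True}"

definition omega_limit :: "(real \<Rightarrow> 'a::topological_space \<Rightarrow> 'a) \<Rightarrow> 'a \<Rightarrow> 'a set" where
  "omega_limit v x = (\<Inter>n::real. closure {v t x |t. t > n})"

definition alpha_limit :: "(real \<Rightarrow> 'a::topological_space \<Rightarrow> 'a) \<Rightarrow> 'a \<Rightarrow> 'a set" where
  "alpha_limit v x = (\<Inter>n::real. closure {v t x |t. t < n})"

definition Sing :: "(real \<Rightarrow> 'a::topological_space \<Rightarrow> 'a) \<Rightarrow> 'a set" where
  "Sing v = {x. \<forall>t. v t x = x}"

definition Per :: "(real \<Rightarrow> 'a::topological_space \<Rightarrow> 'a) \<Rightarrow> 'a set" where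
  "Per v = {x. \<exists>T>0. v T x = x \<and> (\<forall>t\<in>{0<..<T}. v t x \<noteq> x)}"

definition Cl :: "(real \<Rightarrow> 'a::topological_space \<Rightarrow> 'a) \<Rightarrow> 'a set" where
  "Cl v = Sing v \<union> Per v"

definition recurrent :: "(real \<Rightarrow> 'a::topological_space \<Rightarrow> 'a) \<Rightarrow> 'a \<Rightarrow> bool" where
  "recurrent v x \<longleftrightarrow> x \<in> alpha_limit v x \<union> omega_limit v x"

definition Rec :: "(real \<Rightarrow> 'a::topological_space \<Rightarrow> 'a) \<Rightarrow> 'a set" where
  "Rec v = {x. recurrent v x} - Cl v"

definition Nonrec :: "(real \<Rightarrow> 'a::topological_space \<Rightarrow> 'a) \<Rightarrow> 'a set" where
  "Nonrec v = {x. \<not> recurrent v x}"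

text \<open>The one of the four pairwise disjoint sets above that contains the given point.\<close>

definition stratum :: "(real \<Rightarrow> 'a::topological_space \<Rightarrow> 'a) \<Rightarrow> 'a \<Rightarrow> 'a set" where
  "stratum v x =
     (if x \<in> Sing v then Sing v
      else if x \<in> Per v then Per v
      else if x \<in> Nonrec v then Nonrec v
      else Rec v)"

section \<open>Abstract orbits and the abstract orbit space\<close>

definition alpha' :: "(real \<Rightarrow> 'a::topological_space \<Rightarrow> 'a) \<Rightarrow> 'a \<Rightarrow> 'a set" where
  "alpha' v x = alpha_limit v x - orbit v x"

definition omega' :: "(real \<Rightarrow> 'a::topological_space \<Rightarrow> 'a) \<Rightarrow> 'a \<Rightarrow> 'a set" where
  "omega' v x = omega_limit v x - orbit v x"

text \<open>The next three sets are $[x]'$, $[x]''$ and $\hat O(x)$, in this order.\<close>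

definition limit_class :: "(real \<Rightarrow> 'a::topological_space \<Rightarrow> 'a) \<Rightarrow> 'a \<Rightarrow> 'a set" where
  "limit_class v x =
     connected_component_set {y. alpha' v y = alpha' v x \<and> omega' v y = omega' v x} x"

definition limit_stratum_class :: "(real \<Rightarrow> 'a::topological_space \<Rightarrow> 'a) \<Rightarrow> 'a \<Rightarrow> 'a set" where
  "limit_stratum_class v x = connected_component_set (limit_class v x \<inter> stratum v x) x"

definition orbit_class :: "(real \<Rightarrow> 'a::topological_space \<Rightarrow> 'a) \<Rightarrow> 'a \<Rightarrow> 'a set" where
  "orbit_class v x = {y. closure (orbit v y) = closure (orbit v x)}"

definition abstract_orbit :: "(real \<Rightarrow> 'a::topological_space \<Rightarrow> 'a) \<Rightarrow> 'a \<Rightarrow> 'a set" where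
  "abstract_orbit v x = (if x \<in> Rec v then orbit_class v x else limit_stratum_class v x)"

definition abstract_orbits :: "(real \<Rightarrow> 'a::topological_space \<Rightarrow> 'a) \<Rightarrow> 'a set set" where
  "abstract_orbits v = range (abstract_orbit v)"

text \<open>
  The quotient topology on a partition \<open>P\<close> of a space: the points are the members of \<open>P\<close>, and
  a set of points is open iff its union is. This is a topology if \<open>P\<close> is a partition of the
  whole space, see \<open>openin_decomposition_space\<close> and \<open>quotient_map_decomposition_space\<close> below.
\<close>

definition decomposition_space :: "'a::topological_space set set \<Rightarrow> 'a set topology" where
  "decomposition_space P = topology (\<lambda>U. U \<subseteq> P \<and> open (\<Union>U))"

lemma openin_decomposition_space:
  assumes "partition_on UNIV P"
  shows "openin (decomposition_space P) U \<longleftrightarrow> U \<subseteq> P \<and> open (\<Union>U)"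
proof -
  have "istopology (\<lambda>U. U \<subseteq> P \<and> open (\<Union>U))"
    unfolding istopology_def
  proof (intro conjI allI impI)
    fix S T assume S: "S \<subseteq> P \<and> open (\<Union>S)" and T: "T \<subseteq> P \<and> open (\<Union>T)"
    have "\<Union>(S \<inter> T) = \<Union>S \<inter> \<Union>T"
    proof (intro subset_antisym subsetI)
      fix x assume "x \<in> \<Union>S \<inter> \<Union>T"
      then obtain A B where AB: "A \<in> S" "B \<in> T" "x \<in> A" "x \<in> B" by blast
      then have "A = B"
        using S T disjointD[OF partition_onD2[OF assms], of A B] by blast
      then show "x \<in> \<Union>(S \<inter> T)" using AB by blast
    qed blast
    then show "open (\<Union>(S \<inter> T))" using S T by auto
    show "S \<inter> T \<subseteq> P" using S by auto
  next
    fix K :: "'a set set set" assume K: "\<forall>S\<in>K. S \<subseteq> P \<and> open (\<Union>S)"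
    have "\<Union>(\<Union>K) = (\<Union>S\<in>K. \<Union>S)" by auto
    then show "open (\<Union>(\<Union>K))" using K by auto
    show "\<Union>K \<subseteq> P" using K by auto
  qed
  then show ?thesis by (simp add: decomposition_space_def)
qed

lemma topspace_decomposition_space:
  assumes "partition_on UNIV P"
  shows "topspace (decomposition_space P) = P"
proof -
  have "openin (decomposition_space P) P"
    using openin_decomposition_space[OF assms, of P] partition_onD1[OF assms, symmetric] by simp
  moreover have "U \<subseteq> P" if "openin (decomposition_space P) U" for U
    using that openin_decomposition_space[OF assms, of U] by simp
  ultimately show ?thesis
    by (metis openin_subset openin_topspace subset_antisym)
qed

lemma quotient_map_decomposition_space:
  assumes "partition_on UNIV P" and "\<And>x. x \<in> q x" and "\<And>x. q x \<in> P"
  shows "quotient_map euclidean (decomposition_space P) q"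
proof -
  have eq: "q x = A" if "A \<in> P" "x \<in> A" for x A
    using disjointD[OF partition_onD2[OF assms(1)] assms(3)[of x] that(1)] assms(2)[of x] that(2)
    by blast
  have "A \<in> range q" if A: "A \<in> P" for A
  proof -
    have "A \<noteq> {}" using A partition_onD3[OF assms(1)] by metis
    then obtain x where "x \<in> A" by blast
    then have "A = q x" using eq[OF A] by simp
    then show ?thesis by (rule range_eqI)
  qed
  then have "range q = P" using assms(3) by (auto simp only: image_iff)
  moreover have "{x. q x \<in> U} = \<Union>U" if U: "U \<subseteq> P" for U
  proof (intro subset_antisym subsetI)
    fix x assume "x \<in> {x. q x \<in> U}"
    then show "x \<in> \<Union>U" using assms(2)[of x] by (intro UnionI[of "q x"]) simp_all
  next
    fix x assume "x \<in> \<Union>U"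
    then obtain A where A: "A \<in> U" "x \<in> A" by (rule UnionE)
    then have "q x = A" using eq U by (simp add: subset_iff)
    then show "x \<in> {x. q x \<in> U}" using A by simp
  qed
  ultimately show ?thesis
    by (simp add: quotient_map_def topspace_decomposition_space[OF assms(1)]
        openin_decomposition_space[OF assms(1)])
qed

definition abstract_orbit_space :: "(real \<Rightarrow> 'a::topological_space \<Rightarrow> 'a) \<Rightarrow> 'a set topology" where
  "abstract_orbit_space v = decomposition_space (abstract_orbits v)"

definition le_alpha :: "(real \<Rightarrow> 'a::topological_space \<Rightarrow> 'a) \<Rightarrow> ('a set \<times> 'a set) set" where
  "le_alpha v = {(A, B). A \<in> abstract_orbits v \<and> B \<in> abstract_orbits v \<and>
     (A = B \<or> (\<exists>x\<in>A. \<exists>y\<in>B. x \<in> alpha_limit v y))}"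

definition le_omega :: "(real \<Rightarrow> 'a::topological_space \<Rightarrow> 'a) \<Rightarrow> ('a set \<times> 'a set) set" where
  "le_omega v = {(A, B). A \<in> abstract_orbits v \<and> B \<in> abstract_orbits v \<and>
     (A = B \<or> (\<exists>x\<in>A. \<exists>y\<in>B. x \<in> omega_limit v y))}"

section \<open>The Morse graph\<close>

definition eps_chain :: "(real \<Rightarrow> 'a::metric_space \<Rightarrow> 'a) \<Rightarrow> real \<Rightarrow> real \<Rightarrow> 'a \<Rightarrow> 'a \<Rightarrow> bool" where
  "eps_chain v \<epsilon> T x y \<longleftrightarrow>
     (\<exists>(k::nat) (xs :: nat \<Rightarrow> 'a) (ts :: nat \<Rightarrow> real). xs 0 = x \<and> xs (Suc k) = y \<and>
        (\<forall>i\<le>k. ts i > T \<and> dist (v (ts i) (xs i)) (xs (Suc i)) < \<epsilon>))"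

definition CR :: "(real \<Rightarrow> 'a::metric_space \<Rightarrow> 'a) \<Rightarrow> 'a set" where
  "CR v = {x. \<forall>\<epsilon>>0. \<forall>T>0. eps_chain v \<epsilon> T x x}"

definition morse_sets :: "(real \<Rightarrow> 'a::metric_space \<Rightarrow> 'a) \<Rightarrow> 'a set set" where
  "morse_sets v = components (CR v)"

definition connecting_set ::
    "(real \<Rightarrow> 'a::metric_space \<Rightarrow> 'a) \<Rightarrow> 'a set \<Rightarrow> 'a set \<Rightarrow> 'a set" where
  "connecting_set v M N = {x. alpha_limit v x \<subseteq> M \<and> omega_limit v x \<subseteq> N}"

definition morse_graph ::
    "(real \<Rightarrow> 'a::metric_space \<Rightarrow> 'a) \<Rightarrow> ('a set, 'a set \<times> 'a set) pre_digraph" where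
  "morse_graph v =
     \<lparr>verts = morse_sets v,
      arcs = {(M, N). M \<in> morse_sets v \<and> N \<in> morse_sets v \<and> M \<noteq> N \<and> connecting_set v M N \<noteq> {}},
      tail = fst,
      head = snd\<rparr>"

text \<open>
  The underlying space of the Morse graph: every vertex is one point (the Morse set itself), and
  every edge \<open>e\<close> is one point, namely the set \<open>edge_set v e\<close> of the points of its connecting orbits.
\<close>

definition edge_set ::
    "(real \<Rightarrow> 'a::metric_space \<Rightarrow> 'a) \<Rightarrow> 'a set \<times> 'a set \<Rightarrow> 'a set" where
  "edge_set v e = connecting_set v (tail (morse_graph v) e) (head (morse_graph v) e)"

definition morse_cells :: "(real \<Rightarrow> 'a::metric_space \<Rightarrow> 'a) \<Rightarrow> 'a set set" where
  "morse_cells v = verts (morse_graph v) \<union> edge_set v ` arcs (morse_graph v)"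

definition morse_space :: "(real \<Rightarrow> 'a::metric_space \<Rightarrow> 'a) \<Rightarrow> 'a set topology" where
  "morse_space v = decomposition_space (morse_cells v)"

text \<open>
  The directed structure of the Morse graph as a pair of reflexive relations on its underlying
  space: an edge is related to its tail by the first one and to its head by the second one.
\<close>

definition morse_tail_rel :: "(real \<Rightarrow> 'a::metric_space \<Rightarrow> 'a) \<Rightarrow> ('a set \<times> 'a set) set" where
  "morse_tail_rel v = Id_on (morse_cells v) \<union>
     {(tail (morse_graph v) e, edge_set v e) |e. e \<in> arcs (morse_graph v)}"

definition morse_head_rel :: "(real \<Rightarrow> 'a::metric_space \<Rightarrow> 'a) \<Rightarrow> ('a set \<times> 'a set) set" where
  "morse_head_rel v = Id_on (morse_cells v) \<union>
     {(head (morse_graph v) e, edge_set v e) |e. e \<in> arcs (morse_graph v)}"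

end

theory Submission
  imports Defs
begin

text \<open>
  Both spaces are decompositions of \<open>X\<close>, so it suffices that every abstract orbit lies in a single
  Morse set or connecting orbit set. Limit sets are connected and chain recurrent, hence each lies in
  one Morse set; Morse sets are closed, invariant and chain transitive, so a point whose two limit
  sets lie in the same Morse set is itself chain recurrent. An abstract orbit of recurrent points
  is contained in a connected set of chain recurrent points. On an abstract orbit of
  non-recurrent points \<open>\<alpha>' = \<alpha>\<close> and \<open>\<omega>' = \<omega>\<close> are constant, so either the orbit lies in a single
  connecting orbit set, or it is a connected subset of the chain recurrent set.
\<close>

section \<open>Decompositions and connectedness\<close>

text \<open>Since \<open>Q\<close> is a partition, \<open>p A\<close> is the only member of
  \<open>Q\<close> that meets \<open>A\<close>. Hence a family \<open>U\<close> and its preimage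
  under \<open>p\<close> have the same union in the underlying space, and openness is the same
  condition on both sides.\<close>

lemma quotient_map_decomposition_refinement:
  assumes P: "partition_on UNIV P" and Q: "partition_on UNIV Q"
    and p: "\<And>A. A \<in> P \<Longrightarrow> p A \<in> Q \<and> A \<subseteq> p A"
  shows "quotient_map (decomposition_space P) (decomposition_space Q) p"
proof -
  have eq: "p A = B" if "A \<in> P" "B \<in> Q" "x \<in> A" "x \<in> B" for A B x
    using p[OF that(1)] that disjointD[OF partition_onD2[OF Q], of "p A" B] by blast
  have "Q \<subseteq> p ` P"
  proof
    fix B assume B: "B \<in> Q"
    with partition_onD3[OF Q] obtain x where "x \<in> B" by (metis ex_in_conv)
    moreover obtain A where "A \<in> P" "x \<in> A" using partition_onD1[OF P] by blast
    ultimately show "B \<in> p ` P" using eq B by blast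
  qed
  then have "p ` P = Q" using p by blast
  \<comment> \<open>Both topologies look only at the union of a family, so this equality is the
    whole topological content.\<close>
  moreover have "\<Union>{A \<in> P. p A \<in> U} = \<Union>U" if U: "U \<subseteq> Q" for U
  proof (intro subset_antisym subsetI)
    fix x assume "x \<in> \<Union>{A \<in> P. p A \<in> U}"
    then show "x \<in> \<Union>U" using p by blast
  next
    fix x assume "x \<in> \<Union>U"
    then obtain B where "B \<in> U" "x \<in> B" by blast
    moreover obtain A where "A \<in> P" "x \<in> A" using partition_onD1[OF P] by blast
    ultimately show "x \<in> \<Union>{A \<in> P. p A \<in> U}" using eq U by blast
  qed
  moreover have "{A \<in> P. p A \<in> U} \<subseteq> P" for U by blast
  ultimately show ?thesis
    by (simp add: quotient_map_def topspace_decomposition_space[OF P]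
        topspace_decomposition_space[OF Q] openin_decomposition_space[OF P]
        openin_decomposition_space[OF Q])
qed

text \<open>A common point \<open>z\<close> of \<open>f x\<close> and \<open>f y\<close> forces
  \<open>f x = f z = f y\<close>.\<close>

lemma partition_on_range:
  assumes "\<And>x. x \<in> f x" and "\<And>x y. y \<in> f x \<Longrightarrow> f y = f x"
  shows "partition_on UNIV (range f)"
proof (rule partition_onI)
  show "\<Union>(range f) = UNIV" using assms(1) by blast
  show "{} \<notin> range f" using assms(1) by (metis empty_iff imageE)
  fix p q assume "p \<in> range f" "q \<in> range f" "p \<noteq> q"
  then show "disjnt p q" using assms(2) unfolding disjnt_iff by (metis imageE)
qed

section \<open>Nested intersections of closed sets in a compact space\<close>

lemma compact_UNIV_nested_nonempty:
  fixes C :: "nat \<Rightarrow> 'a::topological_space set"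
  assumes "compact (UNIV :: 'a set)" and "\<And>n. closed (C n)" and "\<And>n. C n \<noteq> {}" and "decseq C"
  shows "(\<Inter>n. C n) \<noteq> {}"
  using compact_space_imp_nest[of euclidean C] assms by (simp add: compact_space_def)

text \<open>If the intersection split into disjoint closed pieces, disjoint open neighbourhoods of
  the pieces would by compactness cover some \<open>C n\<close> and disconnect it.\<close>

lemma connected_nested_Inter:
  fixes C :: "nat \<Rightarrow> 'a::metric_space set"
  assumes comp: "compact (UNIV :: 'a set)" and cl: "\<And>n. closed (C n)"
    and conn: "\<And>n. connected (C n)" and dec: "decseq C"
  shows "connected (\<Inter>n. C n)"
proof (rule ccontr)
  assume "\<not> connected (\<Inter>n. C n)"
  moreover have "closed (\<Inter>n. C n)" using cl by blast
  ultimately obtain A B where AB: "closed A" "closed B" "A \<noteq> {}" "B \<noteq> {}"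
      "A \<union> B = (\<Inter>n. C n)" "A \<inter> B = {}"
    using connected_closed_set by metis
  \<comment> \<open>The points strictly nearer to one piece form an open set; it contains that piece
    because the pieces are closed, nonempty and disjoint.\<close>
  define U where "U = {z. infdist z A < infdist z B}"
  define V where "V = {z. infdist z B < infdist z A}"
  have op: "open U" "open V" unfolding U_def V_def
    by (intro open_Collect_less continuous_intros)+
  have zero: "infdist z A = 0 \<longleftrightarrow> z \<in> A" "infdist z B = 0 \<longleftrightarrow> z \<in> B" for z
    using AB in_closed_iff_infdist_zero by metis+
  have "A \<subseteq> U" "B \<subseteq> V" unfolding U_def V_def
    using zero AB(6) infdist_nonneg by (smt (verit) disjoint_iff mem_Collect_eq subsetI)+
  have disj: "U \<inter> V = {}" unfolding U_def V_def by auto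
  have "\<exists>n. C n - (U \<union> V) = {}"
  proof (rule ccontr)
    assume "\<nexists>n. C n - (U \<union> V) = {}"
    then have "(\<Inter>n. C n - (U \<union> V)) \<noteq> {}"
    proof (intro compact_UNIV_nested_nonempty)
      show "decseq (\<lambda>n. C n - (U \<union> V))" using dec unfolding decseq_def by blast
      show "closed (C n - (U \<union> V))" for n using cl op by (intro closed_Diff open_Un)
    qed (use comp in auto)
    then show False using AB(5) \<open>A \<subseteq> U\<close> \<open>B \<subseteq> V\<close> by blast
  qed
  then obtain n where n: "C n \<subseteq> U \<union> V" by blast
  have "A \<subseteq> C n" "B \<subseteq> C n" using AB(5) by blast+
  then show False
    using connectedD[OF conn op, of n] n disj AB(3,4) \<open>A \<subseteq> U\<close> \<open>B \<subseteq> V\<close> by blast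
qed

section \<open>Chains\<close>

text \<open>Indices run from \<open>0\<close> to \<open>Suc k\<close>, so there is at least one
  step. This matches the powers \<open>Suc k\<close> of \<open>R\<close> and the closure that is
  transitive without being made reflexive.\<close>

lemma tranclp_iff_sequence:
  "R\<^sup>+\<^sup>+ x y \<longleftrightarrow> (\<exists>k xs. xs 0 = x \<and> xs (Suc k) = y \<and> (\<forall>i\<le>k. R (xs i) (xs (Suc i))))"
proof -
  have "R\<^sup>+\<^sup>+ x y \<longleftrightarrow> (\<exists>k. (R ^^ Suc k) x y)"
    unfolding tranclp_power gr0_conv_Suc by blast
  then show ?thesis by (simp only: relpowp_fun_conv less_Suc_eq_le)
qed

text \<open>A chain is a nonempty path for the relation "flow for a time above \<open>T\<close>,
  then jump by less than \<open>\<epsilon>\<close>". Concatenating and splitting chains thereby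
  become facts about transitive closures.\<close>

lemma eps_chain_iff_tranclp:
  "eps_chain v \<epsilon> T x y \<longleftrightarrow> (\<lambda>x y. \<exists>t>T. dist (v t x) y < \<epsilon>)\<^sup>+\<^sup>+ x y"
proof -
  have "(\<exists>ts. \<forall>i\<le>k. ts i > T \<and> dist (v (ts i) (xs i)) (xs (Suc i)) < \<epsilon>) \<longleftrightarrow>
      (\<forall>i\<le>k. \<exists>t>T. dist (v t (xs i)) (xs (Suc i)) < \<epsilon>)" for k and xs :: "nat \<Rightarrow> 'a"
    by metis
  then show ?thesis unfolding eps_chain_def tranclp_iff_sequence by simp
qed

lemma eps_chain_single:
  "t > T \<Longrightarrow> dist (v t x) y < \<epsilon> \<Longrightarrow> eps_chain v \<epsilon> T x y"
  unfolding eps_chain_iff_tranclp by (rule tranclp.r_into_trancl) blast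

lemma eps_chain_trans:
  "eps_chain v \<epsilon> T x y \<Longrightarrow> eps_chain v \<epsilon> T y z \<Longrightarrow> eps_chain v \<epsilon> T x z"
  unfolding eps_chain_iff_tranclp by (rule tranclp_trans)

lemma eps_chain_mono:
  assumes "eps_chain v \<epsilon> T x y" and "\<epsilon> \<le> \<epsilon>'" and "T' \<le> T"
  shows "eps_chain v \<epsilon>' T' x y"
proof -
  obtain k xs ts where c: "xs 0 = x" "xs (Suc k) = y"
      "\<forall>i\<le>k. ts i > T \<and> dist (v (ts i) (xs i)) (xs (Suc i)) < \<epsilon>"
    using assms(1) unfolding eps_chain_def by blast
  then have "\<forall>i\<le>k. ts i > T' \<and> dist (v (ts i) (xs i)) (xs (Suc i)) < \<epsilon>'"
    using assms(2,3) by force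
  with c(1,2) show ?thesis unfolding eps_chain_def by blast
qed

text \<open>Splitting off an end makes it possible to change the time or the jump of a single step.
  The alternative \<open>w = y\<close> covers chains of one step.\<close>

lemma eps_chain_first_step:
  assumes "eps_chain v \<epsilon> T x y"
  obtains t w where "t > T" "dist (v t x) w < \<epsilon>" "w = y \<or> eps_chain v \<epsilon> T w y"
proof -
  let ?S = "\<lambda>x y. \<exists>t>T. dist (v t x) y < \<epsilon>"
  obtain w where w: "?S x w" "?S\<^sup>*\<^sup>* w y"
    using tranclpD[OF assms[unfolded eps_chain_iff_tranclp]] by blast
  then have "w = y \<or> eps_chain v \<epsilon> T w y"
    unfolding eps_chain_iff_tranclp by (auto dest: rtranclpD)
  with w(1) that show ?thesis by blast
qed

lemma eps_chain_last_step:
  assumes "eps_chain v \<epsilon> T x y"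
  obtains t w where "t > T" "dist (v t w) y < \<epsilon>" "w = x \<or> eps_chain v \<epsilon> T x w"
proof -
  let ?S = "\<lambda>x y. \<exists>t>T. dist (v t x) y < \<epsilon>"
  have "\<exists>w. ?S w y \<and> (w = x \<or> ?S\<^sup>+\<^sup>+ x w)"
    using assms[unfolded eps_chain_iff_tranclp] by (cases rule: tranclp.cases) blast+
  then show ?thesis using that unfolding eps_chain_iff_tranclp by blast
qed

lemma eps_chain_append:
  assumes "w = x \<or> eps_chain v \<epsilon> T x w" and "t > T" and "dist (v t w) y < \<epsilon>"
  shows "eps_chain v \<epsilon> T x y"
  using assms(1) eps_chain_single[of T t v w y \<epsilon>, OF assms(2,3)]
  by (auto intro: eps_chain_trans)

lemma eps_chain_prepend:
  assumes "t > T" and "dist (v t x) w < \<epsilon>" and "w = y \<or> eps_chain v \<epsilon> T w y"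
  shows "eps_chain v \<epsilon> T x y"
  using assms(3) eps_chain_single[of T t v x w \<epsilon>, OF assms(1,2)]
  by (auto intro: eps_chain_trans)

text \<open>Only the last jump changes, by the triangle inequality; the earlier steps are kept with
  the larger tolerance.\<close>

lemma eps_chain_perturb_end:
  assumes c: "eps_chain v \<epsilon> T x y" and d: "dist y z < \<delta>"
  shows "eps_chain v (\<epsilon> + \<delta>) T x z"
proof -
  have "\<delta> \<ge> 0" using d zero_le_dist[of y z] by linarith
  obtain t w where tw: "t > T" "dist (v t w) y < \<epsilon>" "w = x \<or> eps_chain v \<epsilon> T x w"
    using c by (rule eps_chain_last_step)
  have "dist (v t w) z < \<epsilon> + \<delta>" using tw(2) d dist_triangle[of "v t w" z y] by linarith
  moreover have "w = x \<or> eps_chain v (\<epsilon> + \<delta>) T x w"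
    using tw(3) eps_chain_mono[of v \<epsilon> T x w "\<epsilon> + \<delta>" T] \<open>\<delta> \<ge> 0\<close> by auto
  ultimately show ?thesis using tw(1) by (intro eps_chain_append[of w])
qed

text \<open>The last jump is bounded by a strict inequality, so the endpoint can move by the slack
  \<open>\<epsilon> - dist (v t w) y\<close>.\<close>

lemma open_eps_chain: "open {y. eps_chain v \<epsilon> T x y}"
  unfolding open_dist
proof (intro ballI)
  fix y assume "y \<in> {y. eps_chain v \<epsilon> T x y}"
  then obtain t w where tw: "t > T" "dist (v t w) y < \<epsilon>" "w = x \<or> eps_chain v \<epsilon> T x w"
    using eps_chain_last_step[of v \<epsilon> T x y] by blast
  have "eps_chain v \<epsilon> T x z" if "dist z y < \<epsilon> - dist (v t w) y" for z
  proof (rule eps_chain_append[OF tw(3,1)])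
    show "dist (v t w) z < \<epsilon>"
      using that dist_triangle[of "v t w" z y] by (simp add: dist_commute)
  qed
  then show "\<exists>e>0. \<forall>z. dist z y < e \<longrightarrow> z \<in> {y. eps_chain v \<epsilon> T x y}"
    using tw(2) by (intro exI[of _ "\<epsilon> - dist (v t w) y"]) auto
qed

section \<open>Limit sets\<close>

text \<open>Both assumptions survive time reversal, so a fact about omega limit sets can be
  instantiated at the reversed flow to give its alpha counterpart.\<close>

locale compact_flow =
  fixes v :: "real \<Rightarrow> 'a::metric_space \<Rightarrow> 'a"
  assumes compact_UNIV: "compact (UNIV :: 'a set)"
    and flow: "flow v"
begin

lemma flow_0 [simp]: "v 0 x = x"
  using flow unfolding flow_def by blast

lemma flow_add: "v (s + t) x = v s (v t x)"
  using flow unfolding flow_def by blast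

lemma flow_comp: "v s (v t x) = v (s + t) x"
  by (simp add: flow_add)

lemma flow_minus [simp]: "v (- s) (v s x) = x" "v s (v (- s) x) = x"
  by (simp_all add: flow_comp)

lemma continuous_on_flow:
  "continuous_on S f \<Longrightarrow> continuous_on S g \<Longrightarrow> continuous_on S (\<lambda>z. v (f z) (g z))"
  using continuous_on_compose2[of UNIV "\<lambda>(t, x). v t x" S "\<lambda>z. (f z, g z)"] flow
  by (auto simp: flow_def intro: continuous_on_Pair)

lemma flow_continuous:
  assumes "e > 0"
  obtains d where "d > 0" "\<forall>z. dist z y < d \<longrightarrow> dist (v t z) (v t y) < e"
proof -
  have "continuous_on UNIV (v t)"
    by (rule continuous_on_flow[of UNIV "\<lambda>_. t" "\<lambda>x. x"]) (auto intro: continuous_intros)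
  then show ?thesis using that assms unfolding continuous_on_iff by blast
qed

lemma connected_trajectory: "connected S \<Longrightarrow> connected ((\<lambda>t. v t x) ` S)"
  by (intro connected_continuous_image continuous_on_flow continuous_intros)

lemma orbit_image: "orbit v x = range (\<lambda>t. v t x)"
  unfolding orbit_def by blast

lemma self_in_orbit [simp]: "x \<in> orbit v x"
  unfolding orbit_image by (metis flow_0 rangeI)

lemma connected_orbit: "connected (orbit v x)"
  unfolding orbit_image by (intro connected_trajectory) simp

lemma orbit_eq: "y \<in> orbit v x \<Longrightarrow> orbit v y = orbit v x"
proof -
  assume "y \<in> orbit v x"
  then obtain s where "y = v s x" unfolding orbit_def by blast
  moreover have "v t x = v (t - s) (v s x)" "v t (v s x) = v (t + s) x" for t
    by (simp_all add: flow_comp)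
  then have "orbit v x \<subseteq> orbit v (v s x)" "orbit v (v s x) \<subseteq> orbit v x"
    unfolding orbit_def by blast+
  ultimately show ?thesis by blast
qed

lemma mem_omega_limit:
  "z \<in> omega_limit v x \<longleftrightarrow> (\<forall>n. \<forall>e>0. \<exists>t>n. dist (v t x) z < e)"
  unfolding omega_limit_def by (auto simp: closure_approachable) metis+

lemma mem_alpha_limit:
  "z \<in> alpha_limit v x \<longleftrightarrow> (\<forall>n. \<forall>e>0. \<exists>t<n. dist (v t x) z < e)"
  unfolding alpha_limit_def by (auto simp: closure_approachable) metis+

lemma reverse: "compact_flow (\<lambda>t. v (- t))"
proof
  show "compact (UNIV :: 'a set)" by (rule compact_UNIV)
  have "continuous_on UNIV (\<lambda>z::real \<times> 'a. v (- fst z) (snd z))"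
    by (intro continuous_on_flow continuous_intros)
  then show "flow (\<lambda>t. v (- t))"
    by (simp add: flow_def case_prod_unfold flow_comp)
qed

lemma omega_limit_reverse: "omega_limit (\<lambda>t. v (- t)) x = alpha_limit v x"
proof -
  have "z \<in> omega_limit (\<lambda>t. v (- t)) x \<longleftrightarrow> z \<in> alpha_limit v x" for z
    unfolding compact_flow.mem_omega_limit[OF reverse] mem_alpha_limit
    by (metis minus_less_iff minus_minus)
  then show ?thesis by blast
qed

lemma orbit_reverse: "orbit (\<lambda>t. v (- t)) x = orbit v x"
  unfolding orbit_def by (auto, metis minus_minus)

lemma closed_omega_limit: "closed (omega_limit v x)"
  unfolding omega_limit_def by blast

lemma flow_in_omega_limit:
  assumes z: "z \<in> omega_limit v x"
  shows "v s z \<in> omega_limit v x"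
  unfolding mem_omega_limit
proof (intro allI impI)
  fix n e :: real assume "e > 0"
  then obtain d where d: "d > 0" "\<forall>w. dist w z < d \<longrightarrow> dist (v s w) (v s z) < e"
    by (rule flow_continuous)
  obtain t where "t > n - s" "dist (v t x) z < d" using z d(1) unfolding mem_omega_limit by blast
  then show "\<exists>t>n. dist (v t x) (v s z) < e"
    using d(2) by (intro exI[of _ "s + t"]) (auto simp: flow_comp)
qed

lemma closure_orbit_subset_omega_limit:
  assumes "z \<in> omega_limit v x"
  shows "closure (orbit v z) \<subseteq> omega_limit v x"
proof (rule closure_minimal[OF _ closed_omega_limit])
  show "orbit v z \<subseteq> omega_limit v x"
    using flow_in_omega_limit[OF assms] unfolding orbit_def by blast
qed

lemma omega_limit_subset_closure_orbit: "omega_limit v x \<subseteq> closure (orbit v x)"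
proof -
  have "closure {v t x |t. t > 0} \<subseteq> closure (orbit v x)"
    unfolding orbit_def by (rule closure_mono) blast
  then show ?thesis unfolding omega_limit_def by blast
qed

text \<open>Moving the starting point along its orbit shifts all times by a constant. One inclusion
  suffices: the other is the same at \<open>v s x\<close> with shift \<open>- s\<close>.\<close>

lemma omega_limit_flow: "omega_limit v (v s x) = omega_limit v x"
proof -
  have "omega_limit v x \<subseteq> omega_limit v (v s x)" for s x
  proof
    fix z assume z: "z \<in> omega_limit v x"
    show "z \<in> omega_limit v (v s x)" unfolding mem_omega_limit
    proof (intro allI impI)
      fix n e :: real assume "e > 0"
      then obtain t where "t > n + s" "dist (v t x) z < e"
        using z unfolding mem_omega_limit by blast
      then show "\<exists>t>n. dist (v t (v s x)) z < e"
        by (intro exI[of _ "t - s"]) (auto simp: flow_comp)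
    qed
  qed
  from this[of x s] this[of "v s x" "- s"] show ?thesis by simp
qed

lemma omega_limit_orbit: "y \<in> orbit v x \<Longrightarrow> omega_limit v y = omega_limit v x"
  unfolding orbit_def using omega_limit_flow by blast

text \<open>Natural numbers are cofinal in the reals, so the limit set is the intersection of a
  decreasing sequence of closed connected sets, as the compactness lemmas require.\<close>

lemma omega_limit_nested:
  "omega_limit v x = (\<Inter>n. closure ((\<lambda>t. v t x) ` {real n<..}))"
proof -
  have 1: "{v t x |t. t > n} = (\<lambda>t. v t x) ` {n<..}" for n by blast
  have "\<exists>m. closure ((\<lambda>t. v t x) ` {real m<..}) \<subseteq> closure ((\<lambda>t. v t x) ` {n<..})" for n
  proof -
    obtain m where "real m > n" using reals_Archimedean2 by blast
    then show ?thesis by (intro exI[of _ m] closure_mono image_mono) auto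
  qed
  then show ?thesis unfolding omega_limit_def 1 by blast
qed

lemma decseq_closure_trajectory: "decseq (\<lambda>n. closure ((\<lambda>t. v t x) ` {real n<..}))"
  unfolding decseq_def by (intro allI impI closure_mono image_mono) auto

lemma omega_limit_nonempty: "omega_limit v x \<noteq> {}"
  unfolding omega_limit_nested
  by (intro compact_UNIV_nested_nonempty compact_UNIV decseq_closure_trajectory) auto

lemma connected_omega_limit: "connected (omega_limit v x)"
  unfolding omega_limit_nested
  by (intro connected_nested_Inter compact_UNIV decseq_closure_trajectory connected_imp_connected_closure
      connected_trajectory) auto

text \<open>Reversal exchanges the two limit sets and keeps orbits as sets.\<close>

lemmas closure_orbit_subset_alpha_limit =
    compact_flow.closure_orbit_subset_omega_limit[OF reverse,
      unfolded omega_limit_reverse orbit_reverse]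
  and alpha_limit_subset_closure_orbit =
    compact_flow.omega_limit_subset_closure_orbit[OF reverse,
      unfolded omega_limit_reverse orbit_reverse]
  and alpha_limit_orbit =
    compact_flow.omega_limit_orbit[OF reverse, unfolded omega_limit_reverse orbit_reverse]
  and alpha_limit_nonempty =
    compact_flow.omega_limit_nonempty[OF reverse, unfolded omega_limit_reverse]
  and connected_alpha_limit =
    compact_flow.connected_omega_limit[OF reverse, unfolded omega_limit_reverse]

text \<open>A point of the closure outside both limit sets stays away from the two ends of the
  trajectory. It is then in the closure of a compact middle arc, hence on that arc.\<close>

lemma closure_orbit: "closure (orbit v x) = orbit v x \<union> alpha_limit v x \<union> omega_limit v x"
proof (intro subset_antisym subsetI)
  fix z assume z: "z \<in> closure (orbit v x)"
  show "z \<in> orbit v x \<union> alpha_limit v x \<union> omega_limit v x"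
  proof (rule ccontr)
    assume not: "z \<notin> orbit v x \<union> alpha_limit v x \<union> omega_limit v x"
    then obtain m n where mn: "z \<notin> closure {v t x |t. t < m}" "z \<notin> closure {v t x |t. t > n}"
      unfolding alpha_limit_def omega_limit_def by blast
    have "compact ((\<lambda>t. v t x) ` {m..n})"
      by (intro compact_continuous_image continuous_on_flow continuous_intros) auto
    then have "closed ((\<lambda>t. v t x) ` {m..n})" by (rule compact_imp_closed)
    moreover have "orbit v x \<subseteq> {v t x |t. t < m} \<union> (\<lambda>t. v t x) ` {m..n} \<union> {v t x |t. t > n}"
      unfolding orbit_def by force
    then have "z \<in> closure ({v t x |t. t < m} \<union> (\<lambda>t. v t x) ` {m..n} \<union> {v t x |t. t > n})"
      using z closure_mono by blast
    ultimately have "z \<in> (\<lambda>t. v t x) ` {m..n}" using mn by (simp add: closure_Un)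
    then show False using not unfolding orbit_def by blast
  qed
next
  fix z assume "z \<in> orbit v x \<union> alpha_limit v x \<union> omega_limit v x"
  then show "z \<in> closure (orbit v x)"
    using closure_subset alpha_limit_subset_closure_orbit omega_limit_subset_closure_orbit
    by blast
qed

section \<open>Types of points and abstract orbits\<close>

text \<open>This treats singular and periodic points alike: \<open>T\<close> is some period, not
  necessarily minimal, and \<open>1\<close> is taken at singular points.\<close>

lemma Cl_period:
  assumes "x \<in> Cl v"
  obtains T where "T > 0" "\<forall>k::nat. v (real k * T) x = x" "\<forall>k::nat. v (- (real k * T)) x = x"
proof -
  obtain T where T: "T > 0" "v T x = x"
    using assms unfolding Cl_def Sing_def Per_def by (auto intro: that[of 1])
  have 1: "v (real k * T) x = x" for k :: nat
    by (induction k) (simp_all add: distrib_right flow_add T(2))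
  then have "v (- (real k * T)) x = x" for k :: nat by (metis flow_minus(1))
  with T(1) 1 show ?thesis using that by blast
qed

lemma Cl_recurrent: "x \<in> Cl v \<Longrightarrow> recurrent v x"
proof -
  assume "x \<in> Cl v"
  then obtain T where T: "T > 0" "\<forall>k::nat. v (real k * T) x = x" by (rule Cl_period)
  have "x \<in> omega_limit v x" unfolding mem_omega_limit
  proof (intro allI impI)
    fix n e :: real assume "e > 0"
    obtain k where "n < real k * T" using T(1) reals_Archimedean3 by blast
    then show "\<exists>t>n. dist (v t x) x < e" using T(2) \<open>e > 0\<close> by (metis dist_self)
  qed
  then show ?thesis unfolding recurrent_def by blast
qed

text \<open>Reducing times modulo \<open>T\<close> shows that the orbit is the image of the compact
  interval \<open>{0..T}\<close>.\<close>

lemma closed_orbit_Cl: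
  assumes "x \<in> Cl v"
  shows "closed (orbit v x)"
proof -
  obtain T where T: "T > 0" "\<forall>k::nat. v (real k * T) x = x" "\<forall>k::nat. v (- (real k * T)) x = x"
    using assms by (rule Cl_period)
  have "orbit v x \<subseteq> (\<lambda>t. v t x) ` {0..T}"
  proof
    fix z assume "z \<in> orbit v x"
    then obtain t where t: "z = v t x" unfolding orbit_def by blast
    define r where "r = t - of_int \<lfloor>t / T\<rfloor> * T"
    have "v (of_int j * T) x = x" for j :: int
      using T(2)[rule_format, of "nat j"] T(3)[rule_format, of "nat (- j)"] by (cases "j \<ge> 0") auto
    then have "v r x = v r (v (of_int \<lfloor>t / T\<rfloor> * T) x)" by simp
    then have "v r x = z" using t by (simp add: flow_comp r_def)
    moreover have "0 \<le> r" "r \<le> T"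
      using floor_divide_lower[OF T(1), of t] floor_divide_upper[OF T(1), of t]
      unfolding r_def by (simp_all add: algebra_simps)
    ultimately show "z \<in> (\<lambda>t. v t x) ` {0..T}" by force
  qed
  then have "orbit v x = (\<lambda>t. v t x) ` {0..T}" unfolding orbit_def by blast
  moreover have "compact ((\<lambda>t. v t x) ` {0..T})"
    by (intro compact_continuous_image continuous_on_flow continuous_intros) auto
  ultimately show ?thesis by (simp add: compact_imp_closed)
qed

section \<open>The four types of points: disjointness and invariance under the flow\<close>

lemma Sing_Per_disjoint: "Sing v \<inter> Per v = {}"
proof -
  have False if "\<And>t. v t x = x" "T > 0" "\<forall>t\<in>{0<..<T}. v t x \<noteq> x" for x T
    using that(3)[rule_format, of "T / 2"] that by simp
  then show ?thesis unfolding Sing_def Per_def by blast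
qed

lemma not_Rec_cases: "x \<notin> Rec v \<longleftrightarrow> x \<in> Sing v \<or> x \<in> Per v \<or> x \<in> Nonrec v"
  unfolding Rec_def Nonrec_def using Cl_recurrent by (auto simp: Cl_def)

lemma mem_stratum [simp]: "x \<in> stratum v x"
  using not_Rec_cases[of x] unfolding stratum_def by auto

lemma stratum_eq: "y \<in> stratum v x \<Longrightarrow> stratum v y = stratum v x"
  using Sing_Per_disjoint Cl_recurrent not_Rec_cases[of y]
  unfolding stratum_def Nonrec_def Cl_def by (auto split: if_splits)

lemma stratum_not_Rec: "x \<notin> Rec v \<Longrightarrow> y \<in> stratum v x \<Longrightarrow> y \<notin> Rec v"
  unfolding stratum_def using not_Rec_cases by (metis (full_types))

text \<open>A limit set is invariant, so it contains the orbit of each of its points, and limit sets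
  are constant along orbits.\<close>

lemma recurrent_flow: "recurrent v (v s x) \<longleftrightarrow> recurrent v x"
proof -
  have "v s x \<in> orbit v x" "x \<in> orbit v (v s x)" for s x
    unfolding orbit_def by (auto, metis flow_minus(1))
  then have "recurrent v (v s x)" if "recurrent v x" for s x
    using that closure_orbit_subset_omega_limit[of x x] closure_orbit_subset_alpha_limit[of x x]
      closure_subset omega_limit_orbit[of "v s x" x] alpha_limit_orbit[of "v s x" x]
    unfolding recurrent_def by blast
  from this[of x s] this[of "v s x" "- s"] show ?thesis by auto
qed

lemma Sing_flow: "v s x \<in> Sing v \<longleftrightarrow> x \<in> Sing v"
proof -
  have "v s x \<in> Sing v" if "x \<in> Sing v" for s x using that unfolding Sing_def by auto
  from this[of x s] this[of "v s x" "- s"] show ?thesis by auto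
qed

lemma Per_flow: "v s x \<in> Per v \<longleftrightarrow> x \<in> Per v"
proof -
  have "v t (v s x) = v s x \<longleftrightarrow> v t x = x" for t
    by (metis add.commute flow_add flow_minus(1))
  then show ?thesis unfolding Per_def by simp
qed

lemma stratum_orbit: "y \<in> orbit v x \<Longrightarrow> stratum v y = stratum v x"
  unfolding orbit_def stratum_def Nonrec_def
  by (auto simp: recurrent_flow Sing_flow Per_flow)

lemma Rec_orbit: "y \<in> orbit v x \<Longrightarrow> y \<in> Rec v \<longleftrightarrow> x \<in> Rec v"
  unfolding orbit_def Rec_def Cl_def by (auto simp: recurrent_flow Sing_flow Per_flow)

text \<open>If \<open>x\<close> is off the orbit of \<open>y\<close>, that orbit is not closed, so
  \<open>y\<close> is not in \<open>Cl v\<close>. Moreover \<open>x\<close> then lies in a limit set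
  of \<open>y\<close>, which contains the closure of the orbit of \<open>x\<close> and hence
  \<open>y\<close> itself.\<close>

lemma orbit_class_Rec:
  assumes x: "x \<in> Rec v" and eq: "closure (orbit v y) = closure (orbit v x)"
  shows "y \<in> Rec v"
proof (cases "x \<in> orbit v y")
  case True
  then show ?thesis using Rec_orbit x by blast
next
  case False
  have mem: "x \<in> closure (orbit v y)" "y \<in> closure (orbit v x)"
    using eq closure_subset self_in_orbit by blast+
  then have "y \<notin> Cl v" using closed_orbit_Cl[of y] False by auto
  moreover have "y \<in> alpha_limit v y \<union> omega_limit v y"
    using mem False closure_orbit[of y] closure_orbit_subset_alpha_limit[of x y]
      closure_orbit_subset_omega_limit[of x y] by blast
  ultimately show ?thesis unfolding Rec_def recurrent_def by blast
qed

section \<open>Classes of points with equal limit data, and the partition into abstract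
  orbits\<close>

lemma limit_class_refl [simp]: "x \<in> limit_class v x"
  unfolding limit_class_def by simp

lemma limit_class_limits:
  assumes "y \<in> limit_class v x"
  shows "alpha' v y = alpha' v x" "omega' v y = omega' v x"
  using assms connected_component_subset unfolding limit_class_def by blast+

lemma limit_class_eq:
  assumes "y \<in> limit_class v x"
  shows "limit_class v y = limit_class v x"
  using assms limit_class_limits[OF assms] connected_component_eq unfolding limit_class_def
  by fastforce

lemma limit_stratum_class_subset: "limit_stratum_class v x \<subseteq> limit_class v x \<inter> stratum v x"
  unfolding limit_stratum_class_def by (rule connected_component_subset)

lemma limit_stratum_class_eq:
  assumes "y \<in> limit_stratum_class v x"
  shows "limit_stratum_class v y = limit_stratum_class v x"
proof -
  have "limit_class v y = limit_class v x" "stratum v y = stratum v x"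
    using assms limit_stratum_class_subset limit_class_eq stratum_eq by blast+
  then show ?thesis
    using assms connected_component_eq unfolding limit_stratum_class_def by metis
qed

lemma mem_abstract_orbit [simp]: "x \<in> abstract_orbit v x"
  unfolding abstract_orbit_def orbit_class_def limit_stratum_class_def by simp

text \<open>The two branches of the definition never mix: orbit classes of points of
  \<open>Rec v\<close> stay inside \<open>Rec v\<close>, and the other strata stay outside.\<close>

lemma abstract_orbit_eq:
  assumes "y \<in> abstract_orbit v x"
  shows "abstract_orbit v y = abstract_orbit v x"
proof (cases "x \<in> Rec v")
  case True
  then have "closure (orbit v y) = closure (orbit v x)"
    using assms by (simp add: abstract_orbit_def orbit_class_def)
  then show ?thesis
    using True orbit_class_Rec by (simp add: abstract_orbit_def orbit_class_def)
next
  case False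
  then have y: "y \<in> limit_stratum_class v x" using assms by (simp add: abstract_orbit_def)
  then have "y \<notin> Rec v" using limit_stratum_class_subset stratum_not_Rec[OF False] by blast
  with False y show ?thesis by (simp add: abstract_orbit_def limit_stratum_class_eq)
qed

text \<open>Outside \<open>Rec v\<close>, the orbit is a connected set on which the limit data and
  the stratum are constant, so it lies in both connected components.\<close>

lemma orbit_subset_abstract_orbit: "orbit v x \<subseteq> abstract_orbit v x"
proof (cases "x \<in> Rec v")
  case True
  then show ?thesis using orbit_eq by (auto simp: abstract_orbit_def orbit_class_def)
next
  case False
  have "orbit v x \<subseteq> limit_class v x" unfolding limit_class_def
    by (rule connected_component_maximal)
      (auto simp: connected_orbit alpha'_def omega'_def alpha_limit_orbit omega_limit_orbit orbit_eq)
  moreover have "orbit v x \<subseteq> stratum v x" using stratum_orbit mem_stratum by blast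
  ultimately have "orbit v x \<subseteq> limit_stratum_class v x" unfolding limit_stratum_class_def
    by (intro connected_component_maximal) (auto simp: connected_orbit)
  then show ?thesis using False by (simp add: abstract_orbit_def)
qed

lemma partition_abstract_orbits: "partition_on UNIV (abstract_orbits v)"
  unfolding abstract_orbits_def using abstract_orbit_eq by (intro partition_on_range) auto

lemma abstract_orbits_eq:
  "A \<in> abstract_orbits v \<Longrightarrow> x \<in> A \<Longrightarrow> A = abstract_orbit v x"
  using abstract_orbit_eq unfolding abstract_orbits_def by blast

text \<open>\<open>L\<close> stands for either limit set, so one argument serves both pre-orders.
  The difficulty in transitivity is that the two relations may use different representatives
  \<open>y\<close> and \<open>y'\<close> of the middle abstract orbit.\<close>

lemma preorder_on_limit_relation:
  assumes L: "L = alpha_limit v \<or> L = omega_limit v"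
  shows "preorder_on (abstract_orbits v) {(A, B). A \<in> abstract_orbits v \<and> B \<in> abstract_orbits v \<and>
     (A = B \<or> (\<exists>x\<in>A. \<exists>y\<in>B. x \<in> L y))}"
    (is "preorder_on _ ?r")
proof -
  have sub: "closure (orbit v z) \<subseteq> L x" if "z \<in> L x" for x z
    using L that closure_orbit_subset_alpha_limit closure_orbit_subset_omega_limit by blast
  have sup: "L x \<subseteq> closure (orbit v x)" for x
    using L alpha_limit_subset_closure_orbit omega_limit_subset_closure_orbit by blast
  have diff: "L y - orbit v y = L x - orbit v x" if "y \<in> limit_class v x" for x y
    using L limit_class_limits[OF that] unfolding alpha'_def omega'_def by blast
  have "trans ?r"
  proof (rule transI)
    fix A B C assume "(A, B) \<in> ?r" "(B, C) \<in> ?r"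
    then have ABC: "A \<in> abstract_orbits v" "B \<in> abstract_orbits v" "C \<in> abstract_orbits v"
      and AB: "A = B \<or> (\<exists>x\<in>A. \<exists>y\<in>B. x \<in> L y)" and BC: "B = C \<or> (\<exists>x\<in>B. \<exists>y\<in>C. x \<in> L y)"
      by simp_all
    have "A = C \<or> (\<exists>x\<in>A. \<exists>z\<in>C. x \<in> L z)"
    proof (cases "A = B \<or> B = C")
      case True
      then show ?thesis using AB BC by auto
    next
      case False
      then obtain x y y' z
        where xyz: "x \<in> A" "y \<in> B" "x \<in> L y" "y' \<in> B" "z \<in> C" "y' \<in> L z"
        using AB BC by blast
      have B: "B = abstract_orbit v y'" using ABC(2) xyz(4) by (rule abstract_orbits_eq)
      \<comment> \<open>This is enough, since \<open>L z\<close> contains the closure of the orbit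
        of each of its points, in particular of \<open>y'\<close>.\<close>
      have "x \<in> closure (orbit v y')"
      proof (cases "y' \<in> Rec v")
        case True
        then have "closure (orbit v y) = closure (orbit v y')"
          using B xyz(2) by (simp add: abstract_orbit_def orbit_class_def)
        then show ?thesis using sup xyz(3) by blast
      next
        case yRec: False
        \<comment> \<open>On a limit class only \<open>L y - orbit v y\<close> is constant, so
          \<open>x\<close> must be off the orbit of \<open>y\<close>; this uses that
          \<open>A\<close> and \<open>B\<close> differ.\<close>
        have "x \<notin> orbit v y"
        proof
          assume "x \<in> orbit v y"
          then have "x \<in> B"
            using orbit_subset_abstract_orbit[of y] abstract_orbits_eq[OF ABC(2) xyz(2)] by blast
          then have "A = B"
            using abstract_orbits_eq[OF ABC(1) xyz(1)] abstract_orbits_eq[OF ABC(2)] by blast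
          then show False using False by blast
        qed
        moreover have "y \<in> limit_class v y'"
          using B xyz(2) yRec limit_stratum_class_subset by (auto simp: abstract_orbit_def)
        ultimately have "x \<in> L y'" using diff xyz(3) by blast
        then show ?thesis using sup by blast
      qed
      then show ?thesis using xyz sub by blast
    qed
    then show "(A, C) \<in> ?r" using ABC by simp
  qed
  then show ?thesis unfolding preorder_on_def refl_on_def by auto
qed

section \<open>The chain recurrent set and Morse sets\<close>

text \<open>Only the first time changes, from \<open>t\<close> to \<open>t - s\<close>; the surplus
  \<open>\<bar>s\<bar>\<close> keeps it above \<open>T\<close>.\<close>

lemma eps_chain_flow_start:
  assumes "eps_chain v \<epsilon> (T + \<bar>s\<bar>) x z"
  shows "eps_chain v \<epsilon> T (v s x) z"
proof -
  obtain t w where tw: "t > T + \<bar>s\<bar>" "dist (v t x) w < \<epsilon>" "w = z \<or> eps_chain v \<epsilon> (T + \<bar>s\<bar>) w z"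
    using assms by (rule eps_chain_first_step)
  show ?thesis
  proof (rule eps_chain_prepend)
    show "t - s > T" using tw(1) by linarith
    show "dist (v (t - s) (v s x)) w < \<epsilon>" using tw(2) by (simp add: flow_comp)
    show "w = z \<or> eps_chain v \<epsilon> T w z" using tw(3) eps_chain_mono[of v \<epsilon> "T + \<bar>s\<bar>" w z \<epsilon> T] by auto
  qed
qed

text \<open>The chain first follows the flow for time \<open>T + 1\<close> and only then jumps to the trajectory of
  the nearby point; in this way \<open>\<delta>\<close> does not depend on the first time of the given chain.\<close>

lemma eps_chain_perturb_start:
  assumes "\<epsilon> > 0" and "T > 0"
  obtains \<delta> where "\<delta> > 0"
    "\<forall>w z. dist w y < \<delta> \<longrightarrow> eps_chain v \<epsilon> (2 * T + 1) w z \<longrightarrow> eps_chain v \<epsilon> T y z"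
proof -
  obtain \<delta> where \<delta>: "\<delta> > 0" "\<forall>w. dist w y < \<delta> \<longrightarrow> dist (v (T + 1) w) (v (T + 1) y) < \<epsilon>"
    using assms(1) by (rule flow_continuous)
  have "eps_chain v \<epsilon> T y z" if w: "dist w y < \<delta>" and c: "eps_chain v \<epsilon> (2 * T + 1) w z" for w z
  proof (rule eps_chain_trans)
    show "eps_chain v \<epsilon> T y (v (T + 1) w)"
      using \<delta>(2) w by (intro eps_chain_single[of T "T + 1"]) (auto simp: dist_commute)
    show "eps_chain v \<epsilon> T (v (T + 1) w) z"
      using c assms(2) by (intro eps_chain_flow_start) (simp add: algebra_simps)
  qed
  with \<delta>(1) show ?thesis using that by blast
qed

lemma CR_chain: "x \<in> CR v \<Longrightarrow> \<epsilon> > 0 \<Longrightarrow> T > 0 \<Longrightarrow> eps_chain v \<epsilon> T x x"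
  unfolding CR_def by blast

lemma closed_CR: "closed (CR v)"
proof -
  have "y \<in> CR v" if y: "y \<in> closure (CR v)" for y
    unfolding CR_def
  proof (intro CollectI allI impI)
    fix \<epsilon> T :: real assume pos: "\<epsilon> > 0" "T > 0"
    then obtain \<delta> where \<delta>: "\<delta> > 0"
        "\<forall>w z. dist w y < \<delta> \<longrightarrow> eps_chain v \<epsilon> (2 * T + 1) w z \<longrightarrow> eps_chain v \<epsilon> T y z"
      by (rule eps_chain_perturb_start)
    \<comment> \<open>The loop at the nearby point \<open>w\<close> is moved to \<open>y\<close> at
      both ends: \<open>\<epsilon> / 2\<close> pays for the end and \<open>\<delta>\<close> for the
      start.\<close>
    have "min \<delta> (\<epsilon> / 2) > 0" using \<delta>(1) pos by simp
    then obtain w where w: "w \<in> CR v" "dist w y < min \<delta> (\<epsilon> / 2)"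
      using y unfolding closure_approachable by blast
    have "eps_chain v (\<epsilon> / 2) (2 * T + 1) w w" using w(1) pos by (intro CR_chain) auto
    then have "eps_chain v (\<epsilon> / 2 + \<epsilon> / 2) (2 * T + 1) w y"
      using w(2) by (intro eps_chain_perturb_end) auto
    then show "eps_chain v \<epsilon> T y y" using \<delta>(2) w(2) by auto
  qed
  then show ?thesis by (metis closure_subset closure_closed closed_closure subsetI subset_antisym)
qed

lemma flow_in_CR:
  assumes x: "x \<in> CR v"
  shows "v s x \<in> CR v"
  unfolding CR_def
proof (intro CollectI allI impI)
  fix \<epsilon> T :: real assume pos: "\<epsilon> > 0" "T > 0"
  then obtain d where d: "d > 0" "\<forall>w. dist w x < d \<longrightarrow> dist (v s w) (v s x) < \<epsilon>"
    using flow_continuous[OF pos(1)] by blast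
  \<comment> \<open>The last step is prolonged by \<open>s\<close>: the bound \<open>d\<close> keeps
    its jump small after applying \<open>v s\<close>, and \<open>\<bar>s\<bar>\<close> compensates a
    negative \<open>s\<close>.\<close>
  have "eps_chain v (min d \<epsilon>) (T + \<bar>s\<bar>) x x" using x d(1) pos by (intro CR_chain) auto
  then obtain t w where tw: "t > T + \<bar>s\<bar>" "dist (v t w) x < min d \<epsilon>"
      "w = x \<or> eps_chain v (min d \<epsilon>) (T + \<bar>s\<bar>) x w"
    by (rule eps_chain_last_step)
  have "eps_chain v \<epsilon> T x (v s x)"
  proof (rule eps_chain_append)
    show "w = x \<or> eps_chain v \<epsilon> T x w"
      using tw(3) eps_chain_mono[of v "min d \<epsilon>" "T + \<bar>s\<bar>" x w \<epsilon> T] by auto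
    show "s + t > T" using tw(1) by linarith
    show "dist (v (s + t) w) (v s x) < \<epsilon>" using d(2) tw(2) by (simp add: flow_add)
  qed
  moreover have "eps_chain v \<epsilon> T (v s x) x"
    using CR_chain[OF x, of \<epsilon> "T + \<bar>s\<bar>"] pos by (intro eps_chain_flow_start) simp
  ultimately show "eps_chain v \<epsilon> T (v s x) (v s x)" using eps_chain_trans by metis
qed

lemma closure_orbit_subset_CR:
  assumes "x \<in> CR v"
  shows "closure (orbit v x) \<subseteq> CR v"
  using flow_in_CR[OF assms] by (intro closure_minimal closed_CR) (auto simp: orbit_def)

text \<open>Two passes of the trajectory near \<open>y\<close>, separated by more than
  \<open>2 * T + 1\<close>, give a one-step chain from near \<open>y\<close> to \<open>y\<close>,
  whose start is then moved to \<open>y\<close>.\<close>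

lemma omega_limit_subset_CR: "omega_limit v x \<subseteq> CR v"
proof
  fix y assume y: "y \<in> omega_limit v x"
  show "y \<in> CR v" unfolding CR_def
  proof (intro CollectI allI impI)
    fix \<epsilon> T :: real assume pos: "\<epsilon> > 0" "T > 0"
    then obtain \<delta> where \<delta>: "\<delta> > 0"
        "\<forall>w z. dist w y < \<delta> \<longrightarrow> eps_chain v \<epsilon> (2 * T + 1) w z \<longrightarrow> eps_chain v \<epsilon> T y z"
      by (rule eps_chain_perturb_start)
    obtain s where s: "dist (v s x) y < \<delta>" using y \<delta>(1) unfolding mem_omega_limit by blast
    obtain s' where "s' > s + (2 * T + 1)" "dist (v s' x) y < \<epsilon>"
      using y pos unfolding mem_omega_limit by blast
    then have "eps_chain v \<epsilon> (2 * T + 1) (v s x) y"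
      by (intro eps_chain_single[of _ "s' - s"]) (auto simp: flow_comp)
    then show "eps_chain v \<epsilon> T y y" using \<delta>(2) s by blast
  qed
qed

lemma alpha_limit_subset_CR: "alpha_limit v x \<subseteq> CR v"
proof
  fix y assume y: "y \<in> alpha_limit v x"
  show "y \<in> CR v" unfolding CR_def
  proof (intro CollectI allI impI)
    fix \<epsilon> T :: real assume pos: "\<epsilon> > 0" "T > 0"
    then obtain \<delta> where \<delta>: "\<delta> > 0"
        "\<forall>w z. dist w y < \<delta> \<longrightarrow> eps_chain v \<epsilon> (2 * T + 1) w z \<longrightarrow> eps_chain v \<epsilon> T y z"
      by (rule eps_chain_perturb_start)
    \<comment> \<open>Chains run forward in time, so the later pass is fixed first and an earlier
      one is then found before it.\<close>
    obtain s' where s': "dist (v s' x) y < \<epsilon>" using y pos(1) unfolding mem_alpha_limit by blast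
    obtain s where s: "s < s' - (2 * T + 1)" "dist (v s x) y < \<delta>"
      using y \<delta>(1) unfolding mem_alpha_limit by blast
    then have "eps_chain v \<epsilon> (2 * T + 1) (v s x) y"
      using s' by (intro eps_chain_single[of _ "s' - s"]) (auto simp: flow_comp)
    then show "eps_chain v \<epsilon> T y y" using \<delta>(2) s by blast
  qed
qed

lemma recurrent_in_CR: "recurrent v x \<Longrightarrow> x \<in> CR v"
  unfolding recurrent_def using alpha_limit_subset_CR omega_limit_subset_CR by blast

section \<open>Morse sets as components, and chains between their points\<close>

lemma morse_set_containing:
  assumes "connected S" and "S \<noteq> {}" and "S \<subseteq> CR v"
  obtains M where "M \<in> morse_sets v" "S \<subseteq> M"
  using exists_component_superset[of S "CR v"] assms unfolding morse_sets_def by blast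

lemma morse_sets_eq:
  "M \<in> morse_sets v \<Longrightarrow> N \<in> morse_sets v \<Longrightarrow> x \<in> M \<Longrightarrow> x \<in> N \<Longrightarrow> M = N"
  unfolding morse_sets_def using components_eq by blast

lemma morse_set_subset_CR: "M \<in> morse_sets v \<Longrightarrow> M \<subseteq> CR v"
  unfolding morse_sets_def by (rule in_components_subset)

lemma morse_set_nonempty: "M \<in> morse_sets v \<Longrightarrow> M \<noteq> {}"
  unfolding morse_sets_def by (rule in_components_nonempty)

text \<open>The closure of the orbit is connected and chain recurrent, so it stays in the component
  of \<open>x\<close>.\<close>

lemma limits_subset_morse_set:
  assumes M: "M \<in> morse_sets v" and x: "x \<in> M"
  shows "alpha_limit v x \<subseteq> M" "omega_limit v x \<subseteq> M" "closure (orbit v x) \<subseteq> M"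
proof -
  have "closure (orbit v x) \<subseteq> CR v"
    using morse_set_subset_CR[OF M] x by (intro closure_orbit_subset_CR) blast
  then obtain N where N: "N \<in> morse_sets v" "closure (orbit v x) \<subseteq> N"
    using morse_set_containing[of "closure (orbit v x)"] connected_imp_connected_closure[OF connected_orbit]
      self_in_orbit by (metis closure_eq_empty empty_iff)
  then have "x \<in> N" using closure_subset self_in_orbit by blast
  then have "N = M" using morse_sets_eq M N(1) x by blast
  with N(2) show "closure (orbit v x) \<subseteq> M" by blast
  then show "alpha_limit v x \<subseteq> M" "omega_limit v x \<subseteq> M" unfolding closure_orbit by blast+
qed

text \<open>The points reachable from \<open>p\<close> form an open set \<open>U\<close>.
  Unreachable points of \<open>M\<close> have a neighbourhood \<open>V\<close> that avoids
  \<open>U\<close> within \<open>M\<close>, so connectedness leaves no unreachable point. The chains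
  may leave \<open>M\<close>.\<close>

lemma morse_set_chain_transitive:
  assumes M: "M \<in> morse_sets v" and p: "p \<in> M" and q: "q \<in> M" and pos: "\<epsilon> > 0" "T > 0"
  shows "eps_chain v \<epsilon> T p q"
proof -
  define U where "U = {y. eps_chain v \<epsilon> T p y}"
  define V where "V = (\<Union>y\<in>M - U. ball y (\<epsilon> / 2))"
  have "U \<inter> V \<inter> M = {}"
  proof (rule ccontr)
    assume "U \<inter> V \<inter> M \<noteq> {}"
    then obtain r where r: "r \<in> U" "r \<in> V" "r \<in> M" by blast
    then obtain y where "y \<notin> U" "dist y r < \<epsilon> / 2" unfolding V_def by auto
    then have ry: "r \<in> M" "eps_chain v \<epsilon> T p r" "y \<notin> U" "dist y r < \<epsilon> / 2"
      using r unfolding U_def by blast+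
    \<comment> \<open>A loop at \<open>r\<close> with half the tolerance can end at the nearby
      \<open>y\<close> instead, which would make \<open>y\<close> reachable.\<close>
    have "eps_chain v (\<epsilon> / 2) T r r"
      using ry(1) morse_set_subset_CR[OF M] pos by (intro CR_chain) auto
    then have "eps_chain v (\<epsilon> / 2 + \<epsilon> / 2) T r y"
      using ry(4) by (intro eps_chain_perturb_end) (auto simp: dist_commute)
    then have "eps_chain v \<epsilon> T p y" using eps_chain_trans[OF ry(2), of y] by simp
    then show False using ry(3) unfolding U_def by blast
  qed
  moreover have "open U" unfolding U_def by (rule open_eps_chain)
  moreover have "open V" unfolding V_def by blast
  moreover have "M \<subseteq> U \<union> V" unfolding V_def using pos by auto
  moreover have "connected M" using M unfolding morse_sets_def by (rule in_components_connected)
  ultimately have "U \<inter> M = {} \<or> V \<inter> M = {}" using connectedD by metis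
  moreover have "p \<in> U"
    using CR_chain[of p] morse_set_subset_CR[OF M] p pos unfolding U_def by blast
  ultimately have "V \<inter> M = {}" using p by blast
  then have "q \<in> U" using q \<open>M \<subseteq> U \<union> V\<close> by blast
  then show ?thesis unfolding U_def by blast
qed

text \<open>The loop at \<open>x\<close> goes forward to a point \<open>q\<close> of its omega limit
  set, through chains to a point \<open>p\<close> of its alpha limit set, and back to
  \<open>x\<close> along its own past trajectory.\<close>

lemma limits_in_morse_set_imp_CR:
  assumes M: "M \<in> morse_sets v" and \<alpha>: "alpha_limit v x \<subseteq> M" and \<omega>: "omega_limit v x \<subseteq> M"
  shows "x \<in> CR v"
  unfolding CR_def
proof (intro CollectI allI impI)
  fix \<epsilon> T :: real assume pos: "\<epsilon> > 0" "T > 0"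
  obtain p q where p: "p \<in> alpha_limit v x" and q: "q \<in> omega_limit v x"
    using alpha_limit_nonempty omega_limit_nonempty by blast
  obtain t where "t > T" "dist (v t x) q < \<epsilon>" using q pos unfolding mem_omega_limit by blast
  then have 1: "eps_chain v \<epsilon> T x q" by (rule eps_chain_single)
  have 2: "eps_chain v \<epsilon> T q p" using morse_set_chain_transitive[OF M] p q \<alpha> \<omega> pos by blast
  obtain \<delta> where \<delta>: "\<delta> > 0"
      "\<forall>w z. dist w p < \<delta> \<longrightarrow> eps_chain v \<epsilon> (2 * T + 1) w z \<longrightarrow> eps_chain v \<epsilon> T p z"
    using pos by (rule eps_chain_perturb_start)
  obtain s where s: "s < - (2 * T + 1)" "dist (v s x) p < \<delta>"
    using p \<delta>(1) unfolding mem_alpha_limit by blast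
  \<comment> \<open>Flowing for time \<open>- s\<close> arrives exactly at \<open>x\<close>, with a
    jump of length zero.\<close>
  have "eps_chain v \<epsilon> (2 * T + 1) (v s x) x"
    using s(1) pos by (intro eps_chain_single[of _ "- s"]) auto
  then have 3: "eps_chain v \<epsilon> T p x" using \<delta>(2) s(2) by blast
  show "eps_chain v \<epsilon> T x x" using eps_chain_trans[OF eps_chain_trans[OF 1 2] 3] .
qed

section \<open>The decomposition into Morse sets and connecting orbits\<close>

lemma mem_morse_cells:
  "B \<in> morse_cells v \<longleftrightarrow> B \<in> morse_sets v \<or>
     (\<exists>M\<in>morse_sets v. \<exists>N\<in>morse_sets v. M \<noteq> N \<and> B = connecting_set v M N \<and> B \<noteq> {})"
  unfolding morse_cells_def morse_graph_def edge_set_def by (auto simp: image_iff)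

text \<open>A chain recurrent \<open>x\<close> lies in a Morse set containing both of its nonempty
  limit sets; that set would equal both \<open>M\<close> and \<open>N\<close>.\<close>

lemma connecting_set_not_CR:
  assumes "M \<in> morse_sets v" "N \<in> morse_sets v" "M \<noteq> N" "x \<in> connecting_set v M N"
  shows "x \<notin> CR v"
proof
  assume "x \<in> CR v"
  then obtain C where C: "C \<in> morse_sets v" "x \<in> C" using morse_set_containing[of "{x}"] by auto
  obtain p q where "p \<in> alpha_limit v x" "q \<in> omega_limit v x"
    using alpha_limit_nonempty omega_limit_nonempty by blast
  then have "C = M" "C = N"
    using limits_subset_morse_set[OF C] assms C(1) morse_sets_eq unfolding connecting_set_def
    by blast+
  then show False using assms(3) by blast
qed

lemma connecting_set_unique:
  assumes "M \<in> morse_sets v" "N \<in> morse_sets v" "M' \<in> morse_sets v" "N' \<in> morse_sets v"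
    and "x \<in> connecting_set v M N" "x \<in> connecting_set v M' N'"
  shows "M' = M" "N' = N"
proof -
  obtain p q where "p \<in> alpha_limit v x" "q \<in> omega_limit v x"
    using alpha_limit_nonempty omega_limit_nonempty by blast
  then show "M' = M" "N' = N"
    using assms morse_sets_eq unfolding connecting_set_def by blast+
qed

lemma limit_morse_sets:
  obtains M N where "M \<in> morse_sets v" "N \<in> morse_sets v" "x \<in> connecting_set v M N"
proof -
  obtain M where "M \<in> morse_sets v" "alpha_limit v x \<subseteq> M"
    using morse_set_containing[OF connected_alpha_limit alpha_limit_nonempty alpha_limit_subset_CR]
    by blast
  moreover obtain N where "N \<in> morse_sets v" "omega_limit v x \<subseteq> N"
    using morse_set_containing[OF connected_omega_limit omega_limit_nonempty omega_limit_subset_CR]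
    by blast
  ultimately show ?thesis using that unfolding connecting_set_def by blast
qed

text \<open>Chain recurrence of \<open>x\<close> decides whether a cell through it is a vertex or an
  edge, and the limit sets of \<open>x\<close> determine the edge.\<close>

lemma morse_cells_unique:
  assumes "B \<in> morse_cells v" "B' \<in> morse_cells v" "x \<in> B" "x \<in> B'"
  shows "B = B'"
proof (cases "x \<in> CR v")
  case True
  then have "B \<in> morse_sets v" "B' \<in> morse_sets v"
    using assms connecting_set_not_CR unfolding mem_morse_cells by blast+
  then show ?thesis using assms morse_sets_eq by blast
next
  case False
  then have "B \<notin> morse_sets v" "B' \<notin> morse_sets v" using assms morse_set_subset_CR by blast+
  then obtain M N M' N' where
      "M \<in> morse_sets v" "N \<in> morse_sets v" "B = connecting_set v M N"
      "M' \<in> morse_sets v" "N' \<in> morse_sets v" "B' = connecting_set v M' N'"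
    using assms(1,2) unfolding mem_morse_cells by blast
  then show ?thesis using assms(3,4) connecting_set_unique by blast
qed

lemma abstract_orbit_subset_morse_cell:
  "\<exists>B\<in>morse_cells v. abstract_orbit v x \<subseteq> B"
proof (cases "x \<in> Rec v")
  case True
  then have "x \<in> CR v" unfolding Rec_def using recurrent_in_CR by blast
  then obtain M where M: "M \<in> morse_sets v" "x \<in> M" using morse_set_containing[of "{x}"] by auto
  have "y \<in> closure (orbit v x)" if "y \<in> abstract_orbit v x" for y
    using that True closure_subset[of "orbit v y"] self_in_orbit[of y]
    by (auto simp: abstract_orbit_def orbit_class_def)
  then have "abstract_orbit v x \<subseteq> M" using limits_subset_morse_set(3)[OF M] by blast
  then show ?thesis using M(1) mem_morse_cells by blast
next
  case False
  then have eq: "abstract_orbit v x = limit_stratum_class v x" by (simp add: abstract_orbit_def)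
  then have conn: "connected (abstract_orbit v x)" by (simp add: limit_stratum_class_def)
  \<comment> \<open>A connected set of chain recurrent points lies in one component of
    \<open>CR v\<close>, hence in a vertex.\<close>
  have CR_case: ?thesis if "abstract_orbit v x \<subseteq> CR v"
    using morse_set_containing[OF conn _ that] mem_abstract_orbit[of x]
    by (metis empty_iff mem_morse_cells)
  show ?thesis
  proof (cases "x \<in> Nonrec v")
    case False
    then have "x \<in> Sing v \<or> x \<in> Per v" using \<open>x \<notin> Rec v\<close> not_Rec_cases by blast
    then have "stratum v x \<subseteq> Cl v" unfolding stratum_def Cl_def by auto
    then have "abstract_orbit v x \<subseteq> CR v"
      using eq limit_stratum_class_subset[of x] Cl_recurrent recurrent_in_CR by blast
    then show ?thesis by (rule CR_case)
  next
    case True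
    then have str: "stratum v x = Nonrec v"
      unfolding stratum_def Nonrec_def using Cl_recurrent by (auto simp: Cl_def)
    \<comment> \<open>A limit set of \<open>y\<close> meeting the orbit of \<open>y\<close> would
      contain that orbit and make \<open>y\<close> recurrent, so removing the orbit changes
      nothing.\<close>
    have lim': "alpha' v y = alpha_limit v y" "omega' v y = omega_limit v y" if "y \<in> Nonrec v" for y
    proof -
      have "alpha_limit v y \<inter> orbit v y = {}" "omega_limit v y \<inter> orbit v y = {}"
        using that closure_orbit_subset_alpha_limit[of _ y] closure_orbit_subset_omega_limit[of _ y]
          orbit_eq[of _ y] closure_subset self_in_orbit[of y]
        unfolding Nonrec_def recurrent_def by blast+
      then show "alpha' v y = alpha_limit v y" "omega' v y = omega_limit v y"
        unfolding alpha'_def omega'_def by blast+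
    qed
    have lim: "alpha_limit v y = alpha_limit v x \<and> omega_limit v y = omega_limit v x"
      if "y \<in> abstract_orbit v x" for y
    proof -
      have "y \<in> limit_class v x" "y \<in> Nonrec v"
        using that limit_stratum_class_subset[of x] unfolding eq str by blast+
      then show ?thesis using limit_class_limits[of y x] lim' True by metis
    qed
    obtain M N where MN: "M \<in> morse_sets v" "N \<in> morse_sets v" "x \<in> connecting_set v M N"
      by (rule limit_morse_sets)
    then have "y \<in> connecting_set v M N" if "y \<in> abstract_orbit v x" for y
      using lim[OF that] by (simp add: connecting_set_def)
    then have sub: "abstract_orbit v x \<subseteq> connecting_set v M N" by blast
    show ?thesis
    proof (cases "M = N")
      case True
      then have "abstract_orbit v x \<subseteq> CR v"
        using sub limits_in_morse_set_imp_CR[OF MN(1)] unfolding connecting_set_def by blast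
      then show ?thesis by (rule CR_case)
    next
      case False
      then show ?thesis using MN sub mem_morse_cells by blast
    qed
  qed
qed

lemma partition_morse_cells: "partition_on UNIV (morse_cells v)"
proof (rule partition_onI)
  show "\<Union>(morse_cells v) = UNIV"
    using abstract_orbit_subset_morse_cell mem_abstract_orbit by blast
  show "disjnt B B'" if "B \<in> morse_cells v" "B' \<in> morse_cells v" "B \<noteq> B'" for B B'
    using that morse_cells_unique unfolding disjnt_iff by blast
  show "{} \<notin> morse_cells v" using morse_set_nonempty mem_morse_cells by blast
qed

section \<open>Edges of the Morse graph and the images of the two pre-orders\<close>

lemma edge_set_arc:
  assumes "e \<in> arcs (morse_graph v)"
  obtains M N where "e = (M, N)" "M \<in> morse_sets v" "N \<in> morse_sets v" "M \<noteq> N"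
    "edge_set v e = connecting_set v M N" "edge_set v e \<noteq> {}"
    "tail (morse_graph v) e = M" "head (morse_graph v) e = N"
  using assms that unfolding morse_graph_def edge_set_def by auto

lemma arcI:
  assumes "M \<in> morse_sets v" "N \<in> morse_sets v" "M \<noteq> N" "connecting_set v M N \<noteq> {}"
  shows "(M, N) \<in> arcs (morse_graph v)" "edge_set v (M, N) = connecting_set v M N"
    "tail (morse_graph v) (M, N) = M" "head (morse_graph v) (M, N) = N"
  using assms unfolding morse_graph_def edge_set_def by auto

text \<open>\<open>end_of\<close> is the tail for alpha limits and the head for omega limits, so one
  argument serves both. A relation given by \<open>x \<in> L y\<close> becomes a diagonal pair if
  \<open>y\<close> is chain recurrent, and otherwise relates the edge through \<open>y\<close> to
  its end. Conversely, every point \<open>y\<close> of an edge has some \<open>x\<close> in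
  \<open>L y\<close>.\<close>

lemma limit_relation_image:
  assumes p: "\<And>A. A \<in> abstract_orbits v \<Longrightarrow> p A \<in> morse_cells v \<and> A \<subseteq> p A"
    and ne: "\<And>x. L x \<noteq> {}"
    and end_of: "\<And>e. end_of e = tail (morse_graph v) e \<and> L = alpha_limit v \<or>
      end_of e = head (morse_graph v) e \<and> L = omega_limit v"
  shows "map_prod p p ` {(A, B). A \<in> abstract_orbits v \<and> B \<in> abstract_orbits v \<and>
     (A = B \<or> (\<exists>x\<in>A. \<exists>y\<in>B. x \<in> L y))} =
   Id_on (morse_cells v) \<union> {(end_of e, edge_set v e) |e. e \<in> arcs (morse_graph v)}"
    (is "map_prod p p ` ?r = ?Id \<union> ?E")
proof -
  have p_eq: "p A = B" if "A \<in> abstract_orbits v" "B \<in> morse_cells v" "x \<in> A" "x \<in> B" for A B x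
    using p[OF that(1)] that morse_cells_unique by blast
  have ao: "abstract_orbit v x \<in> abstract_orbits v" for x unfolding abstract_orbits_def by blast
  show ?thesis
  proof (intro subset_antisym subsetI)
    fix c assume "c \<in> map_prod p p ` ?r"
    then obtain A B where c: "c = (p A, p B)" and AB: "A \<in> abstract_orbits v" "B \<in> abstract_orbits v"
      and rel: "A = B \<or> (\<exists>x\<in>A. \<exists>y\<in>B. x \<in> L y)" by auto
    show "c \<in> ?Id \<union> ?E"
    proof (cases "A = B")
      case True
      then show ?thesis using c p[OF AB(1)] by (simp add: Id_on_iff)
    next
      case False
      then obtain x y where xy: "x \<in> A" "y \<in> B" "x \<in> L y" using rel by blast
      obtain M N where MN: "M \<in> morse_sets v" "N \<in> morse_sets v" "y \<in> connecting_set v M N"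
        by (rule limit_morse_sets)
      show ?thesis
      proof (cases "y \<in> CR v")
        case True
        then obtain C where C: "C \<in> morse_sets v" "y \<in> C"
          using morse_set_containing[of "{y}"] by auto
        \<comment> \<open>The Morse set of \<open>y\<close> contains its limit sets, so
          \<open>A\<close> and \<open>B\<close> are both sent to the vertex
          \<open>C\<close>.\<close>
        have "x \<in> C" using limits_subset_morse_set[OF C] xy(3) end_of by blast
        moreover have "C \<in> morse_cells v" using C(1) mem_morse_cells by blast
        ultimately have "p A = C" "p B = C" using p_eq AB xy C(2) by blast+
        then show ?thesis using c \<open>C \<in> morse_cells v\<close> by auto
      next
        case False
        then have "M \<noteq> N"
          using MN limits_in_morse_set_imp_CR unfolding connecting_set_def by blast
        then have e: "(M, N) \<in> arcs (morse_graph v)" "edge_set v (M, N) = connecting_set v M N"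
          "tail (morse_graph v) (M, N) = M" "head (morse_graph v) (M, N) = N"
          using arcI[OF MN(1,2)] MN(3) by (metis empty_iff)+
        have "edge_set v (M, N) \<in> morse_cells v" using e(1) unfolding morse_cells_def by blast
        then have "p B = edge_set v (M, N)" using p_eq AB(2) xy(2) MN(3) e(2) by blast
        moreover have "x \<in> end_of (M, N)"
          using end_of[of "(M, N)"] e(3,4) xy(3) MN(3) unfolding connecting_set_def by auto
        moreover have "end_of (M, N) \<in> morse_cells v"
          using end_of[of "(M, N)"] e(3,4) MN mem_morse_cells by metis
        ultimately have "p A = end_of (M, N)" "p B = edge_set v (M, N)"
          using p_eq AB(1) xy(1) by blast+
        then show ?thesis using c e(1) by blast
      qed
    qed
  next
    fix c assume "c \<in> ?Id \<union> ?E"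
    then show "c \<in> map_prod p p ` ?r"
    proof
      assume "c \<in> ?Id"
      then obtain B where B: "B \<in> morse_cells v" "c = (B, B)" by blast
      then obtain x where "x \<in> B" using partition_onD3[OF partition_morse_cells] by fastforce
      then have "p (abstract_orbit v x) = B" using p_eq[OF ao B(1)] mem_abstract_orbit by blast
      then show ?thesis using B(2) ao
        by (intro image_eqI[of _ _ "(abstract_orbit v x, abstract_orbit v x)"]) auto
    next
      assume "c \<in> ?E"
      then obtain e where e: "e \<in> arcs (morse_graph v)" "c = (end_of e, edge_set v e)" by blast
      obtain M N where MN: "M \<in> morse_sets v" "N \<in> morse_sets v"
          "edge_set v e = connecting_set v M N" "edge_set v e \<noteq> {}"
          "tail (morse_graph v) e = M" "head (morse_graph v) e = N"
        using e(1) by (rule edge_set_arc)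
      obtain y x where y: "y \<in> edge_set v e" and x: "x \<in> L y" using MN(4) ne by blast
      have "x \<in> end_of e"
        using end_of[of e] MN(5,6) x y unfolding MN(3) connecting_set_def by auto
      moreover have "end_of e \<in> morse_cells v" using end_of[of e] MN mem_morse_cells by metis
      ultimately have "p (abstract_orbit v x) = end_of e"
        using p_eq[OF ao] mem_abstract_orbit by blast
      moreover have "edge_set v e \<in> morse_cells v" using e(1) unfolding morse_cells_def by blast
      then have "p (abstract_orbit v y) = edge_set v e"
        using p_eq[OF ao] y mem_abstract_orbit by blast
      moreover have "(abstract_orbit v x, abstract_orbit v y) \<in> ?r"
        using ao x mem_abstract_orbit by blast
      ultimately show ?thesis using e(2)
        by (intro image_eqI[of _ _ "(abstract_orbit v x, abstract_orbit v y)"]) auto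
    qed
  qed
qed

end

theorem theorem5p18:
  fixes v :: "real \<Rightarrow> 'a::metric_space \<Rightarrow> 'a"
  assumes "compact (UNIV :: 'a set)"
    and "flow v"
  shows "partition_on UNIV (abstract_orbits v) \<and>
    partition_on UNIV (morse_cells v) \<and>
    preorder_on (abstract_orbits v) (le_alpha v) \<and>
    preorder_on (abstract_orbits v) (le_omega v) \<and>
    (\<exists>p. quotient_map (abstract_orbit_space v) (morse_space v) p \<and>
         (\<forall>A\<in>abstract_orbits v. A \<subseteq> p A) \<and>
         map_prod p p ` le_alpha v = morse_tail_rel v \<and>
         map_prod p p ` le_omega v = morse_head_rel v)"
proof -
  interpret compact_flow v using assms by unfold_locales
  have "\<forall>A\<in>abstract_orbits v. \<exists>B. B \<in> morse_cells v \<and> A \<subseteq> B"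
    using abstract_orbit_subset_morse_cell unfolding abstract_orbits_def by blast
  \<comment> \<open>On abstract orbits the choice is forced, because these are nonempty and cells
    are disjoint: \<open>p\<close> is the map induced by the identity of the space.\<close>
  then obtain p where p: "\<And>A. A \<in> abstract_orbits v \<Longrightarrow> p A \<in> morse_cells v \<and> A \<subseteq> p A"
    by (metis (no_types))
  have "quotient_map (abstract_orbit_space v) (morse_space v) p"
    unfolding abstract_orbit_space_def morse_space_def
    using partition_abstract_orbits partition_morse_cells p
    by (rule quotient_map_decomposition_refinement)
  moreover have "map_prod p p ` le_alpha v = morse_tail_rel v"
    unfolding le_alpha_def morse_tail_rel_def
    using p alpha_limit_nonempty by (rule limit_relation_image) simp_all
  moreover have "map_prod p p ` le_omega v = morse_head_rel v"
    unfolding le_omega_def morse_head_rel_def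
    using p omega_limit_nonempty by (rule limit_relation_image) simp_all
  moreover have "preorder_on (abstract_orbits v) (le_alpha v)"
    "preorder_on (abstract_orbits v) (le_omega v)"
    unfolding le_alpha_def le_omega_def by (simp_all add: preorder_on_limit_relation)
  ultimately show ?thesis using partition_abstract_orbits partition_morse_cells p by blast
qed

end
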